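(* For primes $p\equiv1\pmod{12}$, let $g_{p^4}$ be the genus of $X_0(p^4)$ and let $V_0,V_\infty$ be the vertical $\mathbb{Q}$-divisors on the minimal regular model $\mathcal{X}_0(p^4)$ over $\mathbb{Z}$ given explicitly in the context. Then $$\frac{1}{g_{p^4}-1}\left(g_{p^4}\langle V_0,V_\infty\rangle-\frac{V_0^2+V_\infty^2}{2}\right)=4\,g_{p^4}\log(p)+o\big(g_{p^4}\log p\big)\quad\text{as }p\to\infty,$$ with $p$ running over primes $\equiv1\pmod{12}$.
   Context: For $p\equiv1\pmod{12}$ one has $g_{p^4}=1+\frac{p(p+1)(p^2-6)-14}{12}$. $\mathcal{X}_0(p^4)$ is the minimal regular model of $X_0(p^4)$ over $\mathbb{Z}$, obtained from Edixhoven's regular model (the minimal resolution of the Katz–Mazur coarse moduli scheme) by contracting three curves. Its fibre over $\mathbb{F}_p$ has components $C_{4,0}',C_{0,4}',C_{3,1}',C_{1,3}'$ (images of the reduced Katz–Mazur $(a,b)$-components $C_{a,b}$), $E_1',E_3'$ (images of exceptional curves over $j=1728$) and $F_1',F_3'$ (images of exceptional curves over $j=0$). Their intersection matrix, in the order $C_{4,0}',C_{0,4}',C_{3,1}',C_{1,3}',E_1',E_3',F_1',F_3'$, is $$\begin{pmatrix} -A & B & D & B & 0&0&0&0\\ B & -A & B & D & 0&0&0&0\\ D & B & -G & B & 1&0&1&0\\ B & D & B & -G & 0&1&0&1\\ 0&0&1&0&-2&0&0&0\\ 0&0&0&1&0&-2&0&0\\ 0&0&1&0&0&0&-3&0\\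 0&0&0&1&0&0&0&-3 \end{pmatrix},$$ $A=\frac{2p^4-2p^3-p^2+2p-1}{24}$, $B=\frac{p^2-1}{24}$, $D=\frac{2p^3-p^2-2p+1}{24}$, $G=\frac{3p^2+2p+19}{24}$. For vertical divisors over $p$, the Arakelov pairing is $\langle V,W\rangle=(V\cdot W)\log p$ with $V\cdot W$ the usual intersection number, and $V^2=\langle V,V\rangle$. The divisors are $V_0=x_1C_{4,0}'+x_2C_{0,4}'+x_3C_{3,1}'+x_4C_{1,3}'+x_5E_1'+x_6E_3'+x_7F_1'+x_8F_3'$ and $V_\infty=x_1'C_{4,0}'+x_2'C_{0,4}'+x_3'C_{3,1}'+x_4'C_{1,3}'+x_5'E_1'+x_6'E_3'+x_7'F_1'+x_8'F_3'$ with $x_1=\frac{3p^5-2p^4-17p^3-30p+28}{p^5-p^3}$, $x_2=\frac{-p^4-4p^3+9p^2+12p+14}{p^4-p^2}$, $x_3=\frac{2p^5-p^4-15p^3-16p+28}{p^4+p^3}$, $x_4=-1$, $x_5=\frac{p^5-\frac12p^4-\frac{15}{2}p^3-8p+14}{p^4+p^3}$, $x_6=-\frac12$, $x_7=\frac{\frac23p^5-\frac{14}{3}p^3-\frac{16}{3}p+\frac{28}{3}}{p^4+p^3}$, $x_8=0$; $x_1'=\frac{-3p^5-4p^4+23p^3+12p^2+30p-28}{p^5-p^3}$, $x_2'=\frac{p^4-2p^3-3p^2-14}{p^4-p^2}$, $x_3'=\frac{-2p^5-p^4+13p^3+16p-28}{p^4+p^3}$, $x_4'=-1$, $x_5'=\frac{-p^5-\frac12p^4+\frac{13}{2}p^3+8p-14}{p^4+p^3}$,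 $x_6'=-\frac12$, $x_7'=\frac{-\frac23p^5+\frac{14}{3}p^3+\frac{16}{3}p-\frac{28}{3}}{p^4+p^3}$, $x_8'=0$. (They are chosen so that, for $m\in\{0,\infty\}$, $K-(2g_{p^4}-2)H_m+V_m$ is orthogonal to all vertical divisors, where $K$ is a canonical divisor of $\mathcal{X}_0(p^4)$ and $H_0,H_\infty$ are the sections given by the cusps $0,\infty$, meeting $C_{0,4}'$ and $C_{4,0}'$ respectively.) *)

theory Defs
  imports "HOL-Analysis.Analysis" "HOL-Library.Landau_Symbols"
    "HOL-Computational_Algebra.Primes"
begin

section \<open>The genus of the modular curve $X_0(N)$\<close>

definition SL2Z :: "(int^2^2) set" where
  "SL2Z = {A. det A = 1}"

definition Gamma0 :: "nat \<Rightarrow> (int^2^2) set" where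
  "Gamma0 N = {A \<in> SL2Z. int N dvd A $ 2 $ 1}"

definition Gamma0_cosets :: "nat \<Rightarrow> (int^2^2) set set" where
  "Gamma0_cosets N = (\<lambda>A. (\<lambda>B. B ** A) ` Gamma0 N) ` SL2Z"

definition fixed_cosets :: "nat \<Rightarrow> int^2^2 \<Rightarrow> (int^2^2) set set" where
  "fixed_cosets N M = {C \<in> Gamma0_cosets N. (\<lambda>A. A ** M) ` C = C}"

text \<open>
  \<open>mat_i\<close> and \<open>mat_rho\<close> generate the stabilizers in \<open>SL2Z\<close> of the points $i$ ($j = 1728$) and
  $e^{\pi \mathrm{i}/3}$ ($j = 0$) of the upper half plane; in $PSL_2(\mathbb{Z})$ they have
  order 2 and 3.
\<close>

definition mat_i :: "int^2^2" where
  "mat_i = vector [vector [0, -1], vector [1, 0]]"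

definition mat_rho :: "int^2^2" where
  "mat_rho = vector [vector [1, -1], vector [1, 0]]"

text \<open>
  The points of $X_0(N)$ above $i$ correspond to the orbits of \<open>mat_i\<close> on the cosets
  \<open>Gamma0 N A\<close>, and the unramified (elliptic) ones to the fixed cosets; similarly for \<open>mat_rho\<close>.
  Note that $-1$ lies in \<open>Gamma0 N\<close>, so cosets in $SL_2$ and $PSL_2$ agree.
\<close>

definition elliptic2 :: "nat \<Rightarrow> nat" where
  "elliptic2 N = card (fixed_cosets N mat_i)"

definition elliptic3 :: "nat \<Rightarrow> nat" where
  "elliptic3 N = card (fixed_cosets N mat_rho)"

text \<open>
  The cusps are the \<open>Gamma0 N\<close>-orbits on $\mathbb{P}^1(\mathbb{Q}) = SL_2(\mathbb{Z})/P$, where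
  $P$ is the stabilizer of $\infty$, i.e. the double cosets
  $\Gamma_0(N) \backslash SL_2(\mathbb{Z}) / P$.
\<close>

definition cusps :: "nat \<Rightarrow> (int^2^2) set set" where
  "cusps N =
     (\<lambda>A. {B ** A ** T | B T. B \<in> Gamma0 N \<and> T \<in> SL2Z \<and> T $ 2 $ 1 = 0}) ` SL2Z"

text \<open>
  Riemann--Hurwitz for $X_0(N) \to X(1) = \mathbb{P}^1$, a covering of degree
  $[SL_2(\mathbb{Z}) : \Gamma_0(N)]$ ramified only above $i$, $\rho$ and $\infty$.
\<close>

definition genus_X0 :: "nat \<Rightarrow> real" where
  "genus_X0 N = 1 + real (card (Gamma0_cosets N)) / 12 - real (elliptic2 N) / 4
     - real (elliptic3 N) / 3 - real (card (cusps N)) / 2"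


section \<open>Vertical divisors over $p$ on the minimal regular model of $X_0(p^4)$\<close>

text \<open>
  The constructors are the components $C_{4,0}', C_{0,4}', C_{3,1}', C_{1,3}', E_1', E_3', F_1', F_3'$
  of the fibre over $\mathbb{F}_p$, for $p \equiv 1 \pmod{12}$.  A vertical $\mathbb{Q}$-divisor
  over $p$ is given by its coefficients.
\<close>

datatype fibre_component = C40 | C04 | C31 | C13 | E1 | E3 | F1 | F3

type_synonym vertical_divisor = "fibre_component \<Rightarrow> rat"

definition fibre_components :: "fibre_component list" where
  "fibre_components = [C40, C04, C31, C13, E1, E3, F1, F3]"

definition intersection_matrix :: "nat \<Rightarrow> rat list list" where
  "intersection_matrix n =
     (let p = of_nat n;
          A = (2*p^4 - 2*p^3 - p^2 + 2*p - 1) / 24;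
          B = (p^2 - 1) / 24;
          D = (2*p^3 - p^2 - 2*p + 1) / 24;
          G = (3*p^2 + 2*p + 19) / 24
      in [[-A,  B,  D,  B,  0,  0,  0,  0],
          [ B, -A,  B,  D,  0,  0,  0,  0],
          [ D,  B, -G,  B,  1,  0,  1,  0],
          [ B,  D,  B, -G,  0,  1,  0,  1],
          [ 0,  0,  1,  0, -2,  0,  0,  0],
          [ 0,  0,  0,  1,  0, -2,  0,  0],
          [ 0,  0,  1,  0,  0,  0, -3,  0],
          [ 0,  0,  0,  1,  0,  0,  0, -3]])"

definition intersection_number :: "nat \<Rightarrow> vertical_divisor \<Rightarrow> vertical_divisor \<Rightarrow> rat" where
  "intersection_number p V W =
     (\<Sum>i<8. \<Sum>j<8. V (fibre_components ! i) * W (fibre_components ! j) *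
        (intersection_matrix p ! i ! j))"

definition arakelov_pairing :: "nat \<Rightarrow> vertical_divisor \<Rightarrow> vertical_divisor \<Rightarrow> real" where
  "arakelov_pairing p V W = of_rat (intersection_number p V W) * ln (real p)"

definition V_zero :: "nat \<Rightarrow> vertical_divisor" where
  "V_zero n C =
     (let p = of_nat n in case C of
        C40 \<Rightarrow> (3*p^5 - 2*p^4 - 17*p^3 - 30*p + 28) / (p^5 - p^3)
      | C04 \<Rightarrow> (- (p^4) - 4*p^3 + 9*p^2 + 12*p + 14) / (p^4 - p^2)
      | C31 \<Rightarrow> (2*p^5 - p^4 - 15*p^3 - 16*p + 28) / (p^4 + p^3)
      | C13 \<Rightarrow> -1
      | E1 \<Rightarrow> (p^5 - 1/2*p^4 - 15/2*p^3 - 8*p + 14) / (p^4 + p^3)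
      | E3 \<Rightarrow> - (1/2)
      | F1 \<Rightarrow> (2/3*p^5 - 14/3*p^3 - 16/3*p + 28/3) / (p^4 + p^3)
      | F3 \<Rightarrow> 0)"

definition V_infinity :: "nat \<Rightarrow> vertical_divisor" where
  "V_infinity n C =
     (let p = of_nat n in case C of
        C40 \<Rightarrow> (-3*p^5 - 4*p^4 + 23*p^3 + 12*p^2 + 30*p - 28) / (p^5 - p^3)
      | C04 \<Rightarrow> (p^4 - 2*p^3 - 3*p^2 - 14) / (p^4 - p^2)
      | C31 \<Rightarrow> (-2*p^5 - p^4 + 13*p^3 + 16*p - 28) / (p^4 + p^3)
      | C13 \<Rightarrow> -1
      | E1 \<Rightarrow> (- (p^5) - 1/2*p^4 + 13/2*p^3 + 8*p - 14) / (p^4 + p^3)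
      | E3 \<Rightarrow> - (1/2)
      | F1 \<Rightarrow> (- (2/3)*p^5 + 14/3*p^3 + 16/3*p - 28/3) / (p^4 + p^3)
      | F3 \<Rightarrow> 0)"

definition primes_1_mod_12 :: "nat filter" where
  "primes_1_mod_12 = inf at_top (principal {p. prime p \<and> p mod 12 = 1})"

end

theory Submission
  imports Defs "HOL-Real_Asymp.Real_Asymp" "HOL-Number_Theory.Cong"
begin

text \<open>
  Both sides are governed by the growth rate in $p$ of the genus and of three intersection numbers.

  The genus. The cosets of $\Gamma_0(p^k)$ are the points of $\mathbb{P}^1(\mathbb{Z}/p^k)$, of which
  there are $p^k + p^{k-1}$ (\<open>card_Gamma0_cosets_prime_power\<close>). An elliptic point is a root of
  $x^2 + 1$ or $x^2 + x + 1$ modulo $p^k$, and there are at most $p$ of either kind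
  (\<open>elliptic_prime_power_le\<close>); translations identify most points of the projective line, which
  leaves at most $p^{k-1} + 1$ cusps (\<open>card_cusps_prime_power_le\<close>). By Riemann--Hurwitz
  $g = p^4/12 + O(p^3)$.

  The intersection numbers. The coefficients of $C_{4,0}'$ and $C_{0,4}'$ tend to constants
  $a, b$, the one of $C_{3,1}'$ grows like $cp$, and the remaining ones are small enough for
  their terms to be of lower order. As
  $A \sim p^4/12$, $D \sim p^3/12$ and $G \sim p^2/8$, only products of these three coefficients
  reach order $p^4$ (\<open>intersection_number_asymp\<close>). With $(a, b, c) = (3, -1, 2)$ for
  $V_0$ and its negative for $V_\infty$, this gives $V_0 \cdot V_\infty \sim p^4/3 \sim 4g$, whereas
  the two self-intersections are $\sim -p^4/3$. After division by $g - 1$, the self-intersections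
  contribute only $O(\log p)$, while $g \langle V_0, V_\infty \rangle$ contributes $4g \log p$ to
  leading order.
\<close>

section \<open>Cosets of $\Gamma_0(N)$ and bottom rows\<close>

abbreviation mat2 :: "int \<Rightarrow> int \<Rightarrow> int \<Rightarrow> int \<Rightarrow> int^2^2" where
  "mat2 a b c d \<equiv> vector [vector [a, b], vector [c, d]]"

definition Gamma0_coset :: "nat \<Rightarrow> int^2^2 \<Rightarrow> (int^2^2) set" where
  "Gamma0_coset N A = (\<lambda>B. B ** A) ` Gamma0 N"

lemma mult_nth_2:
  fixes A B :: "int^2^2"
  shows "(A ** B) $ i $ j = A $ i $ 1 * B $ 1 $ j + A $ i $ 2 * B $ 2 $ j"
  by (simp add: matrix_matrix_mult_def sum_2)

lemma Gamma0_cosets_eq: "Gamma0_cosets N = Gamma0_coset N ` SL2Z"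
  by (simp add: Gamma0_cosets_def Gamma0_coset_def)

lemma mat2_in_SL2Z_iff: "mat2 a b c d \<in> SL2Z \<longleftrightarrow> a * d - b * c = 1"
  by (simp add: SL2Z_def det_2)

lemma SL2Z_mult: "A \<in> SL2Z \<Longrightarrow> B \<in> SL2Z \<Longrightarrow> A ** B \<in> SL2Z"
  by (simp add: SL2Z_def det_mul)

lemma Gamma0_mult: "A \<in> Gamma0 N \<Longrightarrow> B \<in> Gamma0 N \<Longrightarrow> A ** B \<in> Gamma0 N"
  by (simp add: Gamma0_def SL2Z_mult mult_nth_2)

definition adjugate2 :: "int^2^2 \<Rightarrow> int^2^2" where
  "adjugate2 A = mat2 (A $ 2 $ 2) (- A $ 1 $ 2) (- A $ 2 $ 1) (A $ 1 $ 1)"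

lemma adjugate2_in_SL2Z: "A \<in> SL2Z \<Longrightarrow> adjugate2 A \<in> SL2Z"
  by (simp add: adjugate2_def SL2Z_def det_2 algebra_simps)

lemma adjugate2_mult:
  assumes "A \<in> SL2Z"
  shows "adjugate2 A ** A = mat 1" "A ** adjugate2 A = mat 1"
  using assms
  by (simp_all add: SL2Z_def det_2 adjugate2_def vec_eq_iff forall_2 mult_nth_2 mat_def algebra_simps)

lemma adjugate2_in_Gamma0: "A \<in> Gamma0 N \<Longrightarrow> adjugate2 A \<in> Gamma0 N"
  by (simp add: Gamma0_def adjugate2_in_SL2Z) (simp add: adjugate2_def)

text \<open>
  The bottom left entry of $A B^{-1}$ is the $2 \times 2$ determinant of the bottom rows of $A$
  and $B$, so cosets are points of $\mathbb{P}^1(\mathbb{Z}/N)$.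
\<close>

lemma Gamma0_coset_eq_iff:
  assumes "A \<in> SL2Z" "B \<in> SL2Z"
  shows "Gamma0_coset N A = Gamma0_coset N B \<longleftrightarrow>
           int N dvd A $ 2 $ 1 * B $ 2 $ 2 - A $ 2 $ 2 * B $ 2 $ 1"
proof -
  have entry: "(A ** adjugate2 B) $ 2 $ 1 = A $ 2 $ 1 * B $ 2 $ 2 - A $ 2 $ 2 * B $ 2 $ 1"
    by (simp add: mult_nth_2 adjugate2_def)
  have "Gamma0_coset N A = Gamma0_coset N B \<longleftrightarrow> A ** adjugate2 B \<in> Gamma0 N"
  proof
    assume eq: "Gamma0_coset N A = Gamma0_coset N B"
    have "mat 1 \<in> Gamma0 N"
      by (simp add: Gamma0_def SL2Z_def) (simp add: mat_def)
    then have "mat 1 ** A \<in> Gamma0_coset N A"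
      unfolding Gamma0_coset_def by (rule imageI)
    then obtain C where C: "C \<in> Gamma0 N" "A = C ** B"
      unfolding eq by (auto simp: Gamma0_coset_def)
    have "A ** adjugate2 B = C"
      using C(2) adjugate2_mult(2)[OF assms(2)] by (simp flip: matrix_mul_assoc)
    then show "A ** adjugate2 B \<in> Gamma0 N" using C(1) by simp
  next
    assume G: "A ** adjugate2 B \<in> Gamma0 N"
    define C where "C = A ** adjugate2 B"
    have A: "A = C ** B"
      unfolding C_def using adjugate2_mult(1)[OF assms(2)] by (simp flip: matrix_mul_assoc)
    have C: "C \<in> Gamma0 N" using G by (simp add: C_def)
    then have C': "C \<in> SL2Z" by (simp add: Gamma0_def)
    have B: "B = adjugate2 C ** A"
      using adjugate2_mult(1)[OF C'] by (simp add: A matrix_mul_assoc)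
    show "Gamma0_coset N A = Gamma0_coset N B"
    proof
      show "Gamma0_coset N A \<subseteq> Gamma0_coset N B"
        using C by (auto simp: Gamma0_coset_def A matrix_mul_assoc intro!: Gamma0_mult)
      show "Gamma0_coset N B \<subseteq> Gamma0_coset N A"
        using adjugate2_in_Gamma0[OF C]
        by (subst (1) B) (auto simp: Gamma0_coset_def matrix_mul_assoc intro!: Gamma0_mult)
    qed
  qed
  also have "\<dots> \<longleftrightarrow> int N dvd A $ 2 $ 1 * B $ 2 $ 2 - A $ 2 $ 2 * B $ 2 $ 1"
    using SL2Z_mult[OF assms(1) adjugate2_in_SL2Z[OF assms(2)]] entry by (simp add: Gamma0_def)
  finally show ?thesis .
qed

lemma Gamma0_coset_mult:
  "(\<lambda>X. X ** M) ` Gamma0_coset N A = Gamma0_coset N (A ** M)"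
  by (simp add: Gamma0_coset_def image_image matrix_mul_assoc)


section \<open>The cosets for a prime power level\<close>

text \<open>
  The affine points $(x : 1)$ of the projective line, and the points $(1 : y)$, which complete
  them when $p \mid y$.
\<close>

definition affine_rep :: "int \<Rightarrow> int^2^2" where
  "affine_rep x = mat2 1 0 x 1"

definition infinite_rep :: "int \<Rightarrow> int^2^2" where
  "infinite_rep y = mat2 0 (-1) 1 y"

lemma rep_simps [simp]:
  "affine_rep x $ 2 $ 1 = x" "affine_rep x $ 2 $ 2 = 1"
  "infinite_rep y $ 2 $ 1 = 1" "infinite_rep y $ 2 $ 2 = y"
  "affine_rep x \<in> SL2Z" "infinite_rep y \<in> SL2Z"
  by (simp_all add: affine_rep_def infinite_rep_def mat2_in_SL2Z_iff)

lemma solve_congruence_prime_power: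
  fixes p k :: nat and a b :: int
  assumes "prime p" "\<not> int p dvd a"
  shows "\<exists>x. 0 \<le> x \<and> x < int (p ^ k) \<and> int (p ^ k) dvd a * x - b"
proof -
  have "prime (int p)" using assms(1) by simp
  then have "coprime (int p) a" using assms(2) by (rule prime_imp_coprime)
  then have "coprime a (int (p ^ k))" by (simp add: coprime_commute)
  then obtain u where "[a * u = 1] (mod int (p ^ k))"
    using cong_solve_coprime_int by blast
  then have "[a * u * b = 1 * b] (mod int (p ^ k))"
    by (rule cong_mult) simp
  then have "[a * (u * b mod int (p ^ k)) = b] (mod int (p ^ k))"
    by (simp add: cong_def mod_mult_right_eq mult.assoc)
  then have "int (p ^ k) dvd a * (u * b mod int (p ^ k)) - b"
    by (simp add: cong_iff_dvd_diff)
  moreover have "int (p ^ k) > 0" using assms(1) prime_gt_0_nat by simp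
  ultimately show ?thesis by (meson pos_mod_bound pos_mod_sign)
qed

lemma dvd_diff_small_imp_eq:
  fixes x y n :: int
  assumes "n dvd x - y" "0 \<le> x" "x < n" "0 \<le> y" "y < n"
  shows "x = y"
  using assms by (metis mod_eq_dvd_iff mod_pos_pos_trivial)

text \<open>
  The entries of a bottom row $(c, d)$ are coprime, so one of them is a unit modulo $p^k$: if $d$
  is, the row is equivalent to $(c/d, 1)$, and otherwise to $(1, d/c)$ with $p \mid d/c$.
\<close>

lemma Gamma0_cosets_prime_power:
  fixes p k :: nat
  assumes p: "prime p" and k: "k > 0"
  shows "Gamma0_cosets (p ^ k) =
           (Gamma0_coset (p ^ k) \<circ> affine_rep) ` {0..<int (p ^ k)} \<union>
           (\<lambda>z. Gamma0_coset (p ^ k) (infinite_rep (int p * z))) ` {0..<int (p ^ (k - 1))}"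
    (is "_ = ?S \<union> ?T")
proof
  let ?N = "p ^ k"
  have N: "int ?N = int p * int (p ^ (k - 1))"
    using k by (cases k) auto
  show "?S \<union> ?T \<subseteq> Gamma0_cosets ?N" by (auto simp: Gamma0_cosets_eq)
  show "Gamma0_cosets ?N \<subseteq> ?S \<union> ?T"
  proof
    fix X assume "X \<in> Gamma0_cosets ?N"
    then obtain A where A: "A \<in> SL2Z" and X: "X = Gamma0_coset ?N A"
      by (auto simp: Gamma0_cosets_eq)
    define c d where "c = A $ 2 $ 1" and "d = A $ 2 $ 2"
    have det: "A $ 1 $ 1 * d - A $ 1 $ 2 * c = 1"
      using A by (simp add: SL2Z_def det_2 c_def d_def)
    show "X \<in> ?S \<union> ?T"
    proof (cases "int p dvd d")
      case False
      obtain x where x: "0 \<le> x" "x < int ?N" "int ?N dvd d * x - c"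
        using solve_congruence_prime_power[OF p False] by blast
      have "X = Gamma0_coset ?N (affine_rep x)"
        unfolding X using A x(3) Gamma0_coset_eq_iff[OF A, of "affine_rep x" ?N]
        by (simp add: c_def d_def dvd_diff_commute)
      then show ?thesis using x(1,2) by auto
    next
      case True
      have c: "\<not> int p dvd c"
      proof
        assume "int p dvd c"
        with True have "int p dvd A $ 1 $ 1 * d - A $ 1 $ 2 * c" by simp
        then have "int p dvd 1" by (simp only: det)
        then show False using p by (simp add: prime_gt_1_nat)
      qed
      obtain y where y: "0 \<le> y" "y < int ?N" "int ?N dvd c * y - d"
        using solve_congruence_prime_power[OF p c] by blast
      have "int p dvd c * y - d" using y(3) N by (metis dvd_mult_left)
      then have "int p dvd c * y" using True by (metis dvd_diff_right_iff dvd_diff_commute)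
      then have "int p dvd y" using c p by (simp add: prime_dvd_mult_iff)
      then obtain z where z: "y = int p * z" by auto
      have p0: "int p > 0" using p prime_gt_0_nat by simp
      have zb: "0 \<le> z" "z < int (p ^ (k - 1))"
        using y(1,2) p0 unfolding z N by (simp_all add: zero_le_mult_iff)
      have "X = Gamma0_coset ?N (infinite_rep y)"
        unfolding X using A y(3) Gamma0_coset_eq_iff[OF A, of "infinite_rep y" ?N]
        by (simp add: c_def d_def)
      then show ?thesis using zb z by auto
    qed
  qed
qed

lemma card_Gamma0_cosets_prime_power:
  fixes p k :: nat
  assumes p: "prime p" and k: "k > 0"
  shows "card (Gamma0_cosets (p ^ k)) = p ^ k + p ^ (k - 1)"
proof -
  let ?N = "p ^ k"
  let ?s = "Gamma0_coset ?N \<circ> affine_rep"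
  let ?t = "\<lambda>z. Gamma0_coset ?N (infinite_rep (int p * z))"
  have N: "int ?N = int p * int (p ^ (k - 1))"
    using k by (cases k) auto
  have p0: "int p > 0" using p prime_gt_0_nat by simp
  have s: "inj_on ?s {0..<int ?N}"
    by (auto simp: inj_on_def Gamma0_coset_eq_iff intro: dvd_diff_small_imp_eq)
  have t: "inj_on ?t {0..<int (p ^ (k - 1))}"
  proof (rule inj_onI)
    fix y z assume y: "y \<in> {0..<int (p ^ (k - 1))}" and z: "z \<in> {0..<int (p ^ (k - 1))}"
      and "?t y = ?t z"
    then have "int ?N dvd int p * (z - y)"
      by (simp add: Gamma0_coset_eq_iff right_diff_distrib)
    then have "int (p ^ (k - 1)) dvd z - y" using p0 unfolding N by simp
    then have "z = y" using y z by (intro dvd_diff_small_imp_eq) auto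
    then show "y = z" by simp
  qed
  have disj: "?s ` {0..<int ?N} \<inter> ?t ` {0..<int (p ^ (k - 1))} = {}"
  proof -
    have "?s x \<noteq> ?t z" for x z
    proof
      assume "?s x = ?t z"
      then have "int ?N dvd x * (int p * z) - 1" by (simp add: Gamma0_coset_eq_iff)
      then have "int p dvd x * (int p * z) - 1" unfolding N by (metis dvd_mult_left)
      moreover have "int p dvd x * (int p * z)" by simp
      ultimately have "int p dvd 1" by (metis dvd_diff_right_iff)
      then show False using p by (simp add: prime_gt_1_nat)
    qed
    then show ?thesis by blast
  qed
  show ?thesis
    unfolding Gamma0_cosets_prime_power[OF assms]
    using card_Un_disjoint[OF _ _ disj] card_image[OF s] card_image[OF t]
    by (simp add: nat_power_eq)
qed


section \<open>Elliptic points and cusps for a prime power level\<close>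

text \<open>
  Let $f(x) = x^2 + tx + 1$. For two roots in the same class modulo $p$, the second factor of
  $f(x) - f(y) = (x - y)(x + y + t)$ is $\equiv 2x + t$, hence prime to $p$ because
  $(2x + t)^2 = 4 f(x) + (t^2 - 4)$. So a root modulo $p$ lifts in at most one way.
\<close>

lemma card_quadratic_roots_prime_power_le:
  fixes p k :: nat and t :: int
  assumes p: "prime p" and k: "k > 0" and t: "\<not> int p dvd t\<^sup>2 - 4"
  shows "card {x \<in> {0..<int (p ^ k)}. int (p ^ k) dvd x\<^sup>2 + t * x + 1} \<le> p"
    (is "card ?R \<le> p")
proof -
  let ?N = "int (p ^ k)"
  have pN: "int p dvd ?N" using k by (simp add: dvd_power)
  have p0: "int p > 0" using p prime_gt_0_nat by simp
  have "inj_on (\<lambda>x. x mod int p) ?R"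
  proof (rule inj_onI)
    fix x y assume x: "x \<in> ?R" and y: "y \<in> ?R" and "x mod int p = y mod int p"
    then have xy: "int p dvd x - y" by (simp add: mod_eq_dvd_iff)
    have px: "int p dvd x\<^sup>2 + t * x + 1" using x pN by (auto intro: dvd_trans)
    have nd: "\<not> int p dvd x + y + t"
    proof
      assume "int p dvd x + y + t"
      then have "int p dvd (x + y + t) + (x - y)" using xy by (rule dvd_add)
      then have "int p dvd 2 * x + t" by (simp add: algebra_simps)
      then have "int p dvd (2 * x + t) * (2 * x + t) - 4 * (x\<^sup>2 + t * x + 1)"
        using px by (intro dvd_diff dvd_mult) auto
      also have "(2 * x + t) * (2 * x + t) - 4 * (x\<^sup>2 + t * x + 1) = t\<^sup>2 - 4"
        by (simp add: power2_eq_square algebra_simps)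
      finally show False using t by simp
    qed
    have "prime (int p)" using p by simp
    then have cop: "coprime ?N (x + y + t)" using nd by (simp add: prime_imp_coprime)
    have "?N dvd (x\<^sup>2 + t * x + 1) - (y\<^sup>2 + t * y + 1)"
      using x y by (intro dvd_diff) auto
    also have "(x\<^sup>2 + t * x + 1) - (y\<^sup>2 + t * y + 1) = (x - y) * (x + y + t)"
      by (simp add: power2_eq_square algebra_simps)
    finally have "?N dvd x - y" using cop by (simp add: coprime_dvd_mult_left_iff)
    then show "x = y" using x y by (auto intro: dvd_diff_small_imp_eq)
  qed
  moreover have "(\<lambda>x. x mod int p) ` ?R \<subseteq> {0..<int p}" using p0 by auto
  ultimately have "card ?R \<le> card {0..<int p}"
    using card_inj_on_le by blast
  then show ?thesis by simp
qed

text \<open>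
  The matrix sends the row $(x, 1)$ to $(tx + 1, -x)$, which is proportional to it iff
  $x^2 + tx + 1 \equiv 0$. For the rows $(1, y)$ the condition is $y^2 + ty + 1 \equiv 0$, which is
  impossible if $p \mid y$.
\<close>

lemma card_fixed_cosets_prime_power_le:
  fixes p k :: nat and t :: int
  assumes p: "prime p" and k: "k > 0" and t: "\<not> int p dvd t\<^sup>2 - 4"
  shows "card (fixed_cosets (p ^ k) (mat2 t (-1) 1 0)) \<le> p"
proof -
  let ?N = "p ^ k" and ?M = "mat2 t (-1) 1 0"
  let ?R = "{x \<in> {0..<int ?N}. int ?N dvd x\<^sup>2 + t * x + 1}"
  have pN: "int p dvd int ?N" using k by (simp add: dvd_power)
  have M: "?M \<in> SL2Z" by (simp add: mat2_in_SL2Z_iff)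
  have fix_iff: "(\<lambda>X. X ** ?M) ` Gamma0_coset ?N A = Gamma0_coset ?N A \<longleftrightarrow>
      int ?N dvd (A $ 2 $ 1)\<^sup>2 + t * A $ 2 $ 1 * A $ 2 $ 2 + (A $ 2 $ 2)\<^sup>2"
    if A: "A \<in> SL2Z" for A
    unfolding Gamma0_coset_mult Gamma0_coset_eq_iff[OF SL2Z_mult[OF A M] A]
    by (simp add: mult_nth_2 power2_eq_square algebra_simps)
  have "fixed_cosets ?N ?M \<subseteq> (Gamma0_coset ?N \<circ> affine_rep) ` ?R"
  proof
    fix X assume "X \<in> fixed_cosets ?N ?M"
    then have X: "X \<in> Gamma0_cosets ?N" and fixed: "(\<lambda>A. A ** ?M) ` X = X"
      by (auto simp: fixed_cosets_def)
    from X consider x where "x \<in> {0..<int ?N}" "X = Gamma0_coset ?N (affine_rep x)"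
      | z where "X = Gamma0_coset ?N (infinite_rep (int p * z))"
      unfolding Gamma0_cosets_prime_power[OF p k] by auto
    then show "X \<in> (Gamma0_coset ?N \<circ> affine_rep) ` ?R"
    proof cases
      case 1
      then have "int ?N dvd x\<^sup>2 + t * x + 1" using fixed fix_iff[of "affine_rep x"] by simp
      then show ?thesis using 1 by auto
    next
      case 2
      then have "int ?N dvd 1 + t * (int p * z) + (int p * z)\<^sup>2"
        using fixed fix_iff[of "infinite_rep (int p * z)"] by simp
      then have "int p dvd 1 + t * (int p * z) + (int p * z)\<^sup>2" by (rule dvd_trans[OF pN])
      also have "1 + t * (int p * z) + (int p * z)\<^sup>2 = 1 + int p * (t * z + int p * z\<^sup>2)"
        by (simp add: power2_eq_square algebra_simps)
      finally have "int p dvd 1" by (metis dvd_add_left_iff dvd_triv_left)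
      then show ?thesis using p by (simp add: prime_gt_1_nat)
    qed
  qed
  moreover have "finite ?R" by (rule finite_subset[of _ "{0..<int ?N}"]) auto
  ultimately have "card (fixed_cosets ?N ?M) \<le> card ((Gamma0_coset ?N \<circ> affine_rep) ` ?R)"
    by (intro card_mono finite_imageI)
  also have "\<dots> \<le> card ?R" using \<open>finite ?R\<close> by (rule card_image_le)
  also have "\<dots> \<le> p" by (rule card_quadratic_roots_prime_power_le[OF assms])
  finally show ?thesis .
qed

lemma elliptic_prime_power_le:
  fixes p k :: nat
  assumes p: "prime p" and "p > 3" and k: "k > 0"
  shows "elliptic2 (p ^ k) \<le> p" "elliptic3 (p ^ k) \<le> p"
proof -
  have "\<not> int p dvd 0\<^sup>2 - 4"
  proof
    assume "int p dvd 0\<^sup>2 - 4"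
    then have "int p dvd 2 ^ 2" by simp
    then have "int p dvd 2" using p prime_dvd_power by (metis prime_nat_int_transfer)
    then show False using \<open>p > 3\<close> zdvd_imp_le by fastforce
  qed
  from card_fixed_cosets_prime_power_le[OF p k this]
  show "elliptic2 (p ^ k) \<le> p" by (simp add: elliptic2_def mat_i_def)
  have "\<not> int p dvd 1\<^sup>2 - 4"
    using \<open>p > 3\<close> zdvd_imp_le[of "int p" 3] by auto
  from card_fixed_cosets_prime_power_le[OF p k this]
  show "elliptic3 (p ^ k) \<le> p" by (simp add: elliptic3_def mat_rho_def)
qed

text \<open>
  Translations $T^n$ move $(1, y)$ to $(1, y + n)$ and $(x, 1)$ to $(x, nx + 1)$.  Hence all cosets
  except those of the rows $(x, 1)$ with $p \mid x$ lie over the cusp of the row $(1, 0)$.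
\<close>

lemma card_cusps_prime_power_le:
  fixes p k :: nat
  assumes p: "prime p" and k: "k > 0"
  shows "card (cusps (p ^ k)) \<le> p ^ (k - 1) + 1"
proof -
  let ?N = "p ^ k"
  define P where "P = {T \<in> SL2Z. T $ 2 $ 1 = 0}"
  define cusp where "cusp X = {Y ** T | Y T. Y \<in> X \<and> T \<in> P}" for X :: "(int^2^2) set"
  have N: "int ?N = int p * int (p ^ (k - 1))"
    using k by (cases k) auto
  have p0: "int p > 0" using p prime_gt_0_nat by simp
  have "{B ** A ** T | B T. B \<in> Gamma0 ?N \<and> T \<in> SL2Z \<and> T $ 2 $ 1 = 0}
      = cusp (Gamma0_coset ?N A)" for A
    by (auto simp: cusp_def Gamma0_coset_def P_def)
  then have cusps: "cusps ?N = cusp ` Gamma0_cosets ?N"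
    by (simp add: cusps_def Gamma0_cosets_eq image_image)
  have P_mult: "S ** T \<in> P" if "S \<in> P" "T \<in> P" for S T
    using that by (simp add: P_def SL2Z_mult mult_nth_2)
  have cusp_translate: "cusp (Gamma0_coset ?N (A ** U)) = cusp (Gamma0_coset ?N A)"
    if U: "U \<in> P" for A U
  proof -
    have V: "adjugate2 U \<in> P"
      using U by (simp add: P_def adjugate2_in_SL2Z) (simp add: adjugate2_def)
    \<comment> \<open>Only one inclusion is needed, as it also applies to the inverse of \<open>U\<close>.\<close>
    have *: "cusp ((\<lambda>X. X ** W) ` X) \<subseteq> cusp X" if "W \<in> P" for W X
      using P_mult[OF that] by (force simp: cusp_def matrix_mul_assoc[symmetric])
    have "cusp (Gamma0_coset ?N (A ** U)) \<subseteq> cusp (Gamma0_coset ?N A)"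
      using *[OF U] by (simp flip: Gamma0_coset_mult)
    moreover have "cusp (Gamma0_coset ?N (A ** U ** adjugate2 U))
        \<subseteq> cusp (Gamma0_coset ?N (A ** U))"
      using *[OF V] by (simp flip: Gamma0_coset_mult)
    moreover have "A ** U ** adjugate2 U = A"
      using U adjugate2_mult(2)[of U] by (simp add: P_def flip: matrix_mul_assoc)
    ultimately show ?thesis by auto
  qed
  have translation: "mat2 1 n 0 1 \<in> P" for n
    by (simp add: P_def mat2_in_SL2Z_iff)
  \<comment> \<open>The translation by \<open>n\<close> turns the bottom row into a multiple of $(1, 0)$ modulo $p^k$.\<close>
  have main_cusp: "cusp (Gamma0_coset ?N A) = cusp (Gamma0_coset ?N (infinite_rep 0))"
    if A: "A \<in> SL2Z" and n: "int ?N dvd A $ 2 $ 1 * n + A $ 2 $ 2" for A n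
  proof -
    let ?U = "mat2 1 n 0 1"
    have U: "A ** ?U \<in> SL2Z"
      by (rule SL2Z_mult[OF A]) (simp add: mat2_in_SL2Z_iff)
    have "Gamma0_coset ?N (A ** ?U) = Gamma0_coset ?N (infinite_rep 0)"
      unfolding Gamma0_coset_eq_iff[OF U rep_simps(6)]
      using n dvd_minus_iff[of "int ?N" "A $ 2 $ 1 * n + A $ 2 $ 2"] by (simp add: mult_nth_2)
    then show ?thesis using cusp_translate[OF translation] by metis
  qed
  have "cusps ?N \<subseteq> insert (cusp (Gamma0_coset ?N (infinite_rep 0)))
      ((\<lambda>z. cusp (Gamma0_coset ?N (affine_rep (int p * z)))) ` {0..<int (p ^ (k - 1))})"
    (is "_ \<subseteq> insert ?c ?S")
  proof
    fix Y assume "Y \<in> cusps ?N"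
    then consider x where "x \<in> {0..<int ?N}" "Y = cusp (Gamma0_coset ?N (affine_rep x))"
      | y where "Y = cusp (Gamma0_coset ?N (infinite_rep y))"
      unfolding cusps Gamma0_cosets_prime_power[OF p k] by auto
    then show "Y \<in> insert ?c ?S"
    proof cases
      case 1
      show ?thesis
      proof (cases "int p dvd x")
        case True
        then obtain z where z: "x = int p * z" by auto
        have "0 \<le> z" "z < int (p ^ (k - 1))"
          using 1(1) p0 unfolding z N by (simp_all add: zero_le_mult_iff)
        then show ?thesis using 1(2) z by auto
      next
        case False
        then obtain n where "int ?N dvd x * n - (-1)"
          using solve_congruence_prime_power[OF p] by blast
        then show ?thesis using 1(2) main_cusp[of "affine_rep x" n] by simp
      qed
    next
      case 2
      then show ?thesis using main_cusp[of "infinite_rep y" "-y"] by simp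
    qed
  qed
  then have "card (cusps ?N) \<le> card (insert ?c ?S)"
    by (intro card_mono) simp_all
  also have "\<dots> \<le> Suc (card ?S)" by (rule card_insert_le_m1[THEN order_trans]) auto
  also have "card ?S \<le> card {0..<int (p ^ (k - 1))}" by (intro card_image_le) simp
  finally show ?thesis by (simp add: nat_power_eq)
qed


section \<open>Growth of the genus\<close>

lemma primes_1_mod_12_le: "primes_1_mod_12 \<le> sequentially"
  by (simp add: primes_1_mod_12_def)

lemma eventually_primes_1_mod_12: "eventually (\<lambda>p. prime p \<and> p > 3) primes_1_mod_12"
proof -
  have "eventually (\<lambda>p. prime p \<and> p mod 12 = 1) primes_1_mod_12"
    unfolding primes_1_mod_12_def eventually_inf_principal by simp
  moreover have "eventually (\<lambda>p::nat. p > 3) primes_1_mod_12"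
    using eventually_gt_at_top primes_1_mod_12_le by (rule filter_leD[rotated])
  ultimately show ?thesis by eventually_elim auto
qed

lemma genus_X0_asymp:
  "((\<lambda>p. genus_X0 (p^4) / real p ^ 4) \<longlongrightarrow> 1/12) primes_1_mod_12"
proof (rule tendsto_sandwich)
  let ?lower = "\<lambda>p::nat. (1 + (real p ^ 4 + real p ^ 3) / 12 - real p / 4 - real p / 3
                   - (real p ^ 3 + 1) / 2) / real p ^ 4"
  let ?upper = "\<lambda>p::nat. (1 + (real p ^ 4 + real p ^ 3) / 12) / real p ^ 4"
  have bounds: "?lower p \<le> genus_X0 (p^4) / real p ^ 4 \<and>
      genus_X0 (p^4) / real p ^ 4 \<le> ?upper p" if "prime p" "p > 3" for p
  proof -
    have "real (card (Gamma0_cosets (p^4))) = real p ^ 4 + real p ^ 3"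
      using card_Gamma0_cosets_prime_power[OF that(1), of 4] by simp
    moreover have "real (elliptic2 (p^4)) \<le> real p" "real (elliptic3 (p^4)) \<le> real p"
      using elliptic_prime_power_le[OF that, of 4] by simp_all
    moreover have "real (card (cusps (p^4))) \<le> real (p ^ 3 + 1)"
      using card_cusps_prime_power_le[OF that(1), of 4] by (subst of_nat_le_iff) simp
    ultimately show ?thesis
      unfolding genus_X0_def by (intro conjI divide_right_mono) (auto simp: field_simps)
  qed
  show "eventually (\<lambda>p. ?lower p \<le> genus_X0 (p^4) / real p ^ 4) primes_1_mod_12"
    "eventually (\<lambda>p. genus_X0 (p^4) / real p ^ 4 \<le> ?upper p) primes_1_mod_12"
    using eventually_primes_1_mod_12 by (eventually_elim, use bounds in blast)+
  have "(?lower \<longlongrightarrow> 1/12) sequentially" "(?upper \<longlongrightarrow> 1/12) sequentially"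
    by real_asymp+
  then show "(?lower \<longlongrightarrow> 1/12) primes_1_mod_12" "(?upper \<longlongrightarrow> 1/12) primes_1_mod_12"
    using primes_1_mod_12_le tendsto_mono by blast+
qed


section \<open>Growth of the intersection numbers\<close>

lemma intersection_number_eq:
  fixes n :: nat
  defines "p \<equiv> rat_of_nat n"
  shows "intersection_number n V W =
      - ((2*p^4 - 2*p^3 - p^2 + 2*p - 1) / 24 * (V C40 * W C40 + V C04 * W C04))
      - (3*p^2 + 2*p + 19) / 24 * (V C31 * W C31 + V C13 * W C13)
      + (2*p^3 - p^2 - 2*p + 1) / 24 *
          (V C40 * W C31 + V C31 * W C40 + V C04 * W C13 + V C13 * W C04)
      + (p^2 - 1) / 24 * ((V C40 + V C31) * (W C04 + W C13) + (V C04 + V C13) * (W C40 + W C31))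
      + (V C31 * (W E1 + W F1) + (V E1 + V F1) * W C31
         + V C13 * (W E3 + W F3) + (V E3 + V F3) * W C13)
      - 2 * (V E1 * W E1 + V E3 * W E3) - 3 * (V F1 * W F1 + V F3 * W F3)"
proof -
  have sum8: "(\<Sum>i<8. f i) = f 0 + f 1 + f 2 + f 3 + f 4 + f 5 + f 6 + f 7"
    for f :: "nat \<Rightarrow> rat"
    by (simp add: eval_nat_numeral)
  show ?thesis
    unfolding intersection_number_def sum8 fibre_components_def intersection_matrix_def Let_def
      p_def[symmetric]
    by (simp add: algebra_simps add_divide_distrib diff_divide_distrib)
qed

text \<open>
  The scaling reflects the orders of the matrix entries: next to $A \sim p^4/12$ and
  $G \sim p^2/8$, coefficients of order $1$ on $C_{4,0}'$, $C_{0,4}'$ and of order $p$ on $C_{3,1}'$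
  all contribute to order $p^4$. Order $o(p)$ on $C_{1,3}'$ and $o(p^2)$ on the exceptional
  curves, whose intersection numbers with all components are bounded, is negligible.
\<close>

definition has_growth :: "(nat \<Rightarrow> vertical_divisor) \<Rightarrow> real \<Rightarrow> real \<Rightarrow> real \<Rightarrow> bool" where
  "has_growth V a b c \<longleftrightarrow>
     (\<lambda>p. of_rat (V p C40)) \<longlonglongrightarrow> a \<and>
     (\<lambda>p. of_rat (V p C04)) \<longlonglongrightarrow> b \<and>
     (\<lambda>p. of_rat (V p C31) / real p) \<longlonglongrightarrow> c \<and>
     (\<lambda>p. of_rat (V p C13) / real p) \<longlonglongrightarrow> 0 \<and>
     (\<forall>C \<in> {E1, E3, F1, F3}. (\<lambda>p. of_rat (V p C) / real p ^ 2) \<longlonglongrightarrow> 0)"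

text \<open>
  Divided by $p^4$, the form becomes a polynomial in $1/p$ and the scaled coefficients, so the limit
  can be taken in each of them. The limit form is the leading part of the block of $C_{4,0}'$,
  $C_{0,4}'$, $C_{3,1}'$.
\<close>

lemma intersection_number_asymp:
  assumes V: "has_growth V a b c" and W: "has_growth W a' b' c'"
  shows "(\<lambda>p. of_rat (intersection_number p (V p) (W p)) / real p ^ 4) \<longlonglongrightarrow>
           (a * c' + c * a' - a * a' - b * b') / 12 - c * c' / 8"
proof -
  define v w :: "fibre_component \<Rightarrow> nat \<Rightarrow> real"
    where "v C p = of_rat (V p C)" and "w C p = of_rat (W p C)" for C p
  \<comment> \<open>All powers of \<open>p\<close> not absorbed by the coefficients are powers of its inverse.\<close>
  define r where "r p = 1 / real p" for p :: nat
  have r: "r \<longlonglongrightarrow> 0" unfolding r_def by real_asymp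
  have v: "v C40 \<longlonglongrightarrow> a" "v C04 \<longlonglongrightarrow> b" "(\<lambda>p. v C31 p / real p) \<longlonglongrightarrow> c"
      "(\<lambda>p. v C13 p / real p) \<longlonglongrightarrow> 0"
      "(\<lambda>p. v E1 p / real p ^ 2) \<longlonglongrightarrow> 0" "(\<lambda>p. v E3 p / real p ^ 2) \<longlonglongrightarrow> 0"
      "(\<lambda>p. v F1 p / real p ^ 2) \<longlonglongrightarrow> 0" "(\<lambda>p. v F3 p / real p ^ 2) \<longlonglongrightarrow> 0"
    using V by (auto simp: has_growth_def v_def[abs_def])
  have w: "w C40 \<longlonglongrightarrow> a'" "w C04 \<longlonglongrightarrow> b'" "(\<lambda>p. w C31 p / real p) \<longlonglongrightarrow> c'"
      "(\<lambda>p. w C13 p / real p) \<longlonglongrightarrow> 0"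
      "(\<lambda>p. w E1 p / real p ^ 2) \<longlonglongrightarrow> 0" "(\<lambda>p. w E3 p / real p ^ 2) \<longlonglongrightarrow> 0"
      "(\<lambda>p. w F1 p / real p ^ 2) \<longlonglongrightarrow> 0" "(\<lambda>p. w F3 p / real p ^ 2) \<longlonglongrightarrow> 0"
    using W by (auto simp: has_growth_def w_def[abs_def])
  let ?f = "\<lambda>p.
      - ((2 - 2 * r p - r p ^ 2 + 2 * r p ^ 3 - r p ^ 4) / 24 *
          (v C40 p * w C40 p + v C04 p * w C04 p))
      - (3 + 2 * r p + 19 * r p ^ 2) / 24 * ((v C31 p / real p) * (w C31 p / real p)
           + (v C13 p / real p) * (w C13 p / real p))
      + (2 - r p - 2 * r p ^ 2 + r p ^ 3) / 24 *
          (v C40 p * (w C31 p / real p) + (v C31 p / real p) * w C40 p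
           + v C04 p * (w C13 p / real p) + (v C13 p / real p) * w C04 p)
      + (1 - r p ^ 2) / 24 *
          ((v C40 p * r p + v C31 p / real p) * (w C04 p * r p + w C13 p / real p)
           + (v C04 p * r p + v C13 p / real p) * (w C40 p * r p + w C31 p / real p))
      + r p * ((v C31 p / real p) * (w E1 p / real p ^ 2 + w F1 p / real p ^ 2)
               + (v E1 p / real p ^ 2 + v F1 p / real p ^ 2) * (w C31 p / real p)
               + (v C13 p / real p) * (w E3 p / real p ^ 2 + w F3 p / real p ^ 2)
               + (v E3 p / real p ^ 2 + v F3 p / real p ^ 2) * (w C13 p / real p))
      - 2 * ((v E1 p / real p ^ 2) * (w E1 p / real p ^ 2)
             + (v E3 p / real p ^ 2) * (w E3 p / real p ^ 2))
      - 3 * ((v F1 p / real p ^ 2) * (w F1 p / real p ^ 2)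
             + (v F3 p / real p ^ 2) * (w F3 p / real p ^ 2))"
  have "?f \<longlonglongrightarrow>
      - ((2 - 2 * 0 - 0 ^ 2 + 2 * 0 ^ 3 - 0 ^ 4) / 24 * (a * a' + b * b'))
      - (3 + 2 * 0 + 19 * 0 ^ 2) / 24 * (c * c' + 0 * 0)
      + (2 - 0 - 2 * 0 ^ 2 + 0 ^ 3) / 24 * (a * c' + c * a' + b * 0 + 0 * b')
      + (1 - 0 ^ 2) / 24 * ((a * 0 + c) * (b' * 0 + 0) + (b * 0 + 0) * (a' * 0 + c'))
      + 0 * (c * (0 + 0) + (0 + 0) * c' + 0 * (0 + 0) + (0 + 0) * 0)
      - 2 * (0 * 0 + 0 * 0) - 3 * (0 * 0 + 0 * 0)"
    (is "_ \<longlonglongrightarrow> ?limit")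
    by (intro tendsto_intros r v w) simp_all
  moreover have "?limit = (a * c' + c * a' - a * a' - b * b') / 12 - c * c' / 8"
    by (simp add: field_simps)
  ultimately have "?f \<longlonglongrightarrow> (a * c' + c * a' - a * a' - b * b') / 12 - c * c' / 8"
    by (simp only:)
  moreover have "eventually (\<lambda>p. ?f p = of_rat (intersection_number p (V p) (W p)) / real p ^ 4)
      sequentially"
    using eventually_gt_at_top[of 0]
  proof eventually_elim
    case (elim p)
    define P where "P = real p"
    have P: "P \<noteq> 0" and r_P: "r p = 1 / P" using elim by (simp_all add: P_def r_def)
    have coeffs:
      "2 - 2 * r p - r p ^ 2 + 2 * r p ^ 3 - r p ^ 4 = (2*P^4 - 2*P^3 - P^2 + 2*P - 1) / P^4"
      "3 + 2 * r p + 19 * r p ^ 2 = (3*P^2 + 2*P + 19) / P^2"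
      "2 - r p - 2 * r p ^ 2 + r p ^ 3 = (2*P^3 - P^2 - 2*P + 1) / P^3"
      "1 - r p ^ 2 = (P^2 - 1) / P^2"
      using P unfolding r_P by (simp_all add: field_simps eval_nat_numeral)
    have scale: "x * r p + y / P = (x + y) / P" for x y by (simp add: r_P add_divide_distrib)
    have products: "x / P * (y / P) = x * y / P^2" "x / P^2 * (y / P^2) = x * y / P^4"
      "x / P * (y / P^2) = x * y / P^3" "x / P^2 * (y / P) = x * y / P^3"
      "v C p * (y / P) = v C p * y / P" "x / P * w C p = x * w C p / P" for x y C
      by (simp_all add: eval_nat_numeral)
    have combine: "x / P^4 / 24 * y = (x / 24 * y) / P^4"
      "x / P^2 / 24 * (y / P^2) = (x / 24 * y) / P^4"
      "x / P^3 / 24 * (y / P) = (x / 24 * y) / P^4"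
      "r p * (x / P^3) = x / P^4" "2 * (x / P^4) = 2 * x / P^4" "3 * (x / P^4) = 3 * x / P^4"
      for x y
      by (simp_all add: r_P eval_nat_numeral)
    have "real_of_rat (intersection_number p (V p) (W p)) =
        - ((2*P^4 - 2*P^3 - P^2 + 2*P - 1) / 24 * (v C40 p * w C40 p + v C04 p * w C04 p))
        - (3*P^2 + 2*P + 19) / 24 * (v C31 p * w C31 p + v C13 p * w C13 p)
        + (2*P^3 - P^2 - 2*P + 1) / 24 *
            (v C40 p * w C31 p + v C31 p * w C40 p + v C04 p * w C13 p + v C13 p * w C04 p)
        + (P^2 - 1) / 24 * ((v C40 p + v C31 p) * (w C04 p + w C13 p)
            + (v C04 p + v C13 p) * (w C40 p + w C31 p))
        + (v C31 p * (w E1 p + w F1 p) + (v E1 p + v F1 p) * w C31 p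
           + v C13 p * (w E3 p + w F3 p) + (v E3 p + v F3 p) * w C13 p)
        - 2 * (v E1 p * w E1 p + v E3 p * w E3 p) - 3 * (v F1 p * w F1 p + v F3 p * w F3 p)"
      by (simp add: intersection_number_eq v_def w_def P_def of_rat_add of_rat_mult of_rat_diff
          of_rat_divide of_rat_minus of_rat_power)
    then show ?case
      by (simp only: P_def[symmetric] coeffs scale products combine minus_divide_left
          add_divide_distrib[symmetric] diff_divide_distrib[symmetric])
  qed
  ultimately show ?thesis by (rule Lim_transform_eventually)
qed

lemma V_zero_growth: "has_growth V_zero 3 (-1) 2"
  unfolding has_growth_def V_zero_def Let_def
  by (simp add: of_rat_add of_rat_mult of_rat_diff of_rat_divide of_rat_minus of_rat_power)
    (intro conjI; real_asymp)

lemma V_infinity_growth: "has_growth V_infinity (-3) 1 (-2)"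
  unfolding has_growth_def V_infinity_def Let_def
  by (simp add: of_rat_add of_rat_mult of_rat_diff of_rat_divide of_rat_minus of_rat_power)
    (intro conjI; real_asymp)


theorem proposition4p11:
  shows "(\<lambda>p. 1 / (genus_X0 (p^4) - 1) *
            (genus_X0 (p^4) * arakelov_pairing p (V_zero p) (V_infinity p)
             - (arakelov_pairing p (V_zero p) (V_zero p)
                + arakelov_pairing p (V_infinity p) (V_infinity p)) / 2)
          - 4 * genus_X0 (p^4) * ln (real p))
         \<in> o[primes_1_mod_12](\<lambda>p. genus_X0 (p^4) * ln (real p))"
proof (rule smalloI_tendsto)
  let ?F = primes_1_mod_12
  define G where "G p = genus_X0 (p^4) / real p ^ 4" for p
  define q where "q p = 1 / real p ^ 4" for p :: nat
  define I where "I V W p = of_rat (intersection_number p (V p) (W p)) / real p ^ 4"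
    for V W :: "nat \<Rightarrow> vertical_divisor" and p
  have G: "(G \<longlongrightarrow> 1/12) ?F"
    unfolding G_def by (rule genus_X0_asymp)
  have "q \<longlonglongrightarrow> 0" unfolding q_def by real_asymp
  then have q: "(q \<longlongrightarrow> 0) ?F" using primes_1_mod_12_le tendsto_mono by blast
  have I: "(I V W \<longlongrightarrow> (a * c' + c * a' - a * a' - b * b') / 12 - c * c' / 8) ?F"
    if "has_growth V a b c" "has_growth W a' b' c'" for V W a b c a' b' c'
    using intersection_number_asymp[OF that] primes_1_mod_12_le tendsto_mono
    unfolding I_def by blast
  note I = I[OF V_zero_growth V_infinity_growth] I[OF V_zero_growth V_zero_growth]
    I[OF V_infinity_growth V_infinity_growth]
  have ev: "eventually (\<lambda>p. genus_X0 (p^4) \<noteq> 0 \<and> genus_X0 (p^4) \<noteq> 1 \<and> p > 3) ?F"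
  proof -
    have "((\<lambda>p. G p - q p) \<longlongrightarrow> 1/12 - 0) ?F" by (intro tendsto_intros G q)
    then have "eventually (\<lambda>p. G p - q p > 0) ?F" by (rule order_tendstoD) simp
    moreover have "eventually (\<lambda>p. G p > 0) ?F" using G by (rule order_tendstoD) simp
    ultimately show ?thesis
      using eventually_primes_1_mod_12 by eventually_elim (auto simp: G_def q_def)
  qed
  then show "eventually (\<lambda>p. genus_X0 (p^4) * ln (real p) \<noteq> 0) ?F"
    by eventually_elim auto
  \<comment> \<open>The quotient to be shown to vanish, in terms of quantities divided by $p^4$; \<open>ln p\<close> cancels.\<close>
  let ?f = "\<lambda>p. I V_zero V_infinity p / (G p - q p)
      - q p * ((I V_zero V_zero p + I V_infinity V_infinity p) / 2) / (G p * (G p - q p)) - 4"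
  have "(?f \<longlongrightarrow> ((3 * (-2) + 2 * (-3) - 3 * (-3) - (-1) * 1) / 12 - 2 * (-2) / 8) / (1/12 - 0)
      - 0 * ((((3 * 2 + 2 * 3 - 3 * 3 - (-1) * (-1)) / 12 - 2 * 2 / 8)
         + (((-3) * (-2) + (-2) * (-3) - (-3) * (-3) - 1 * 1) / 12 - (-2) * (-2) / 8)) / 2)
         / (1/12 * (1/12 - 0)) - 4) ?F"
    by (intro tendsto_intros G q I) simp_all
  then have "(?f \<longlongrightarrow> 0) ?F" by simp
  moreover have "eventually (\<lambda>p. ?f p =
      (1 / (genus_X0 (p^4) - 1) *
            (genus_X0 (p^4) * arakelov_pairing p (V_zero p) (V_infinity p)
             - (arakelov_pairing p (V_zero p) (V_zero p)
                + arakelov_pairing p (V_infinity p) (V_infinity p)) / 2)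
          - 4 * genus_X0 (p^4) * ln (real p)) / (genus_X0 (p^4) * ln (real p))) ?F"
    using ev
  proof eventually_elim
    case (elim p)
    define g h P L x y z where "g = genus_X0 (p^4)" and "h = g - 1" and "P = real p ^ 4"
      and "L = ln (real p)"
      and "x = real_of_rat (intersection_number p (V_zero p) (V_infinity p))"
      and "y = real_of_rat (intersection_number p (V_zero p) (V_zero p))"
      and "z = real_of_rat (intersection_number p (V_infinity p) (V_infinity p))"
    note defs = this
    have nz: "P \<noteq> 0" "L \<noteq> 0" "g \<noteq> 0" "h \<noteq> 0"
      using elim by (auto simp: defs)
    have "x / P / (h / P) - 1 / P * ((y / P + z / P) / 2) / (g / P * (h / P)) - 4
        = (1 / h * (g * (x * L) - (y * L + z * L) / 2) - 4 * g * L) / (g * L)"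
      using nz by (simp add: field_simps)
    moreover have "g / P - 1 / P = h / P" by (simp add: h_def diff_divide_distrib)
    ultimately show ?case
      by (simp add: G_def q_def I_def arakelov_pairing_def defs)
  qed
  ultimately show "((\<lambda>p. (1 / (genus_X0 (p^4) - 1) *
            (genus_X0 (p^4) * arakelov_pairing p (V_zero p) (V_infinity p)
             - (arakelov_pairing p (V_zero p) (V_zero p)
                + arakelov_pairing p (V_infinity p) (V_infinity p)) / 2)
          - 4 * genus_X0 (p^4) * ln (real p)) / (genus_X0 (p^4) * ln (real p))) \<longlongrightarrow> 0) ?F"
    by (rule Lim_transform_eventually)
qed

end
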